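(* Let $\mu>0$, let $\gamma,\alpha,b:[t_0,+\infty[\to\mathbb R^+$ be non-negative continuously differentiable functions and let $\sigma:[t_0,+\infty[\to\mathbb R^+$ be a non-negative function such that for all $t\ge t_0$: (G1) $\sigma(t)\big(\gamma(t)\alpha(t)-\dot\alpha(t)-1\big)-2\alpha(t)\dot\sigma(t)\ge0$; (G2) $\sigma(t)\big(\gamma(t)\alpha(t)-\dot\alpha(t)-1\big)-\alpha(t)\dot\sigma(t)\ge0$; (G3) $-\frac{d}{dt}\Big[\sigma(t)\Big(\sigma(t)\big(\gamma(t)\alpha(t)-\dot\alpha(t)\big)-2\alpha(t)\dot\sigma(t)\Big)\Big]\ge0$; (G4) $\alpha(t)\sigma(t)^2b(t)-\frac{d}{dt}(\alpha^2\sigma^2b)(t)=0$. Let $t\in[t_0,+\infty[\,\mapsto(x(t),y(t),\lambda(t))$ be a solution trajectory of (TRIALS), and let $\mathcal E$ be the function defined in the context. Then the following holds: (1) $\mathcal E$ is a non-increasing function, and for all $t\ge t_0$ $$F(x(t),y(t))-F^\star=\mathcal O\Big(\frac{1}{\alpha(t)^2\sigma(t)^2b(t)}\Big).$$ (2) Suppose moreover that the set $\mathscr S$ of saddle points of $\mathcal L$ is non-empty and let $(x^\star,y^\star,\lambda^\star)\in\mathscr S$. Then for all $t\ge t_0$ the following rates and integrability properties are satisfied: (i) $0\le\mathcal L(x(t),y(t),\lambda^\star)-\mathcal L(x^\star,y^\star,\lambda^\star)=\mathcal O\Big(\frac1{\alpha(t)^2\sigma(t)^2b(t)}\Big)$;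 (ii) $\|Ax(t)+By(t)-c\|^2=\mathcal O\Big(\frac1{\alpha(t)^2\sigma(t)^2b(t)}\Big)$; (iii) there exist positive constants $C_1$ and $C_2$ such that $$-\frac{C_1}{\alpha(t)\sigma(t)\sqrt{b(t)}}\le F(x(t),y(t))-F^\star\le\frac{C_2}{\alpha(t)^2\sigma(t)^2b(t)};$$ (iv) $\displaystyle\int_{t_0}^{+\infty}\alpha(t)\sigma(t)^2b(t)\|Ax(t)+By(t)-c\|^2\,dt<+\infty$; (v) $\displaystyle\int_{t_0}^{+\infty}k(t)\|(\dot x(t),\dot y(t),\dot\lambda(t))\|^2\,dt<+\infty$, where $$k(t)=\alpha(t)\sigma(t)\Big(\sigma(t)\big(\gamma(t)\alpha(t)-\dot\alpha(t)-1\big)-\alpha(t)\dot\sigma(t)\Big).$$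
   Context: Standing assumptions: $\mathcal X,\mathcal Y,\mathcal Z$ are real Hilbert spaces; $f:\mathcal X\to\mathbb R$ and $g:\mathcal Y\to\mathbb R$ are convex and of class $C^1$; $A:\mathcal X\to\mathcal Z$ and $B:\mathcal Y\to\mathcal Z$ are continuous linear operators with adjoints $A^*,B^*$; $c\in\mathcal Z$; $F(x,y):=f(x)+g(y)$; the problem $(\mathcal P)$: $\min\{F(x,y): Ax+By=c\}$ has a non-empty solution set, and $F^\star$ is its optimal value. Lagrangian: $\mathcal L(x,y,\lambda):=F(x,y)+\langle\lambda,Ax+By-c\rangle$; augmented Lagrangian: $\mathcal L_\mu(x,y,\lambda):=\mathcal L(x,y,\lambda)+\frac\mu2\|Ax+By-c\|^2$. A saddle point of $\mathcal L$ is $(x^\star,y^\star,\lambda^\star)$ with $\mathcal L(x^\star,y^\star,\lambda)\le\mathcal L(x^\star,y^\star,\lambda^\star)\le\mathcal L(x,y,\lambda^\star)$ for all $(x,y,\lambda)$; $\mathscr S$ is the set of saddle points. The system (TRIALS) is, for $t\ge t_0$, $$\begin{cases}\ddot x+\gamma(t)\dot x+b(t)\big(\nabla f(x)+A^*[\lambda+\alpha(t)\dot\lambda+\mu(Ax+By-c)]\big)=0\\ \ddot y+\gamma(t)\dot y+b(t)\big(\nabla g(y)+B^*[\lambda+\alpha(t)\dot\lambda+\mu(Ax+By-c)]\big)=0\\ \ddot\lambda+\gamma(t)\dot\lambda-b(t)\big(A(x+\alpha(t)\dot x)+B(y+\alpha(t)\dot y)-c\big)=0.\end{cases}$$ A solution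 trajectory is a classical ($C^2$) solution on $[t_0,+\infty[$. Let $(x^\star,y^\star)$ be a solution of $(\mathcal P)$ and let $\lambda^\star\in\mathcal Z$ be arbitrary (in part (2), $(x^\star,y^\star,\lambda^\star)$ is a saddle point). Put $\delta(t):=\sigma(t)\alpha(t)$, $\xi(t):=\sigma(t)^2\big(\gamma(t)\alpha(t)-\dot\alpha(t)-1\big)-2\alpha(t)\sigma(t)\dot\sigma(t)$, $w(t):=(x(t),y(t),\lambda(t))$, $w^\star:=(x^\star,y^\star,\lambda^\star)$, $v(t):=\sigma(t)(w(t)-w^\star)+\delta(t)\dot w(t)$, and $$\mathcal E(t):=\delta(t)^2b(t)\big(\mathcal L_\mu(x(t),y(t),\lambda^\star)-\mathcal L_\mu(x^\star,y^\star,\lambda^\star)\big)+\tfrac12\|v(t)\|^2+\tfrac12\xi(t)\|w(t)-w^\star\|^2.$$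
   Formalization: In (1) the rate for F−F* is stated as an upper bound only (F−F* ≤ C/(α²σ²b)), since the two-sided O fails in general when no saddle point exists; rates are asserted where α²σ²b>0, and the lower bound is the one in (2)(iii). *)

theory Defs
  imports "HOL-Analysis.Analysis"
begin

(* The library has no class of real Hilbert spaces; the sort {real_inner, banach} is used. *)

definition feasible_set ::
  "('a::{real_inner,banach} \<Rightarrow> 'z::{real_inner,banach}) \<Rightarrow> ('b::{real_inner,banach} \<Rightarrow> 'z) \<Rightarrow> 'z
    \<Rightarrow> ('a \<times> 'b) set" where
  "feasible_set A B c = {(x, y). A x + B y = c}"

definition objective :: "('a \<Rightarrow> real) \<Rightarrow> ('b \<Rightarrow> real) \<Rightarrow> 'a \<Rightarrow> 'b \<Rightarrow> real" where
  "objective f g x y = f x + g y"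

definition solution_set ::
  "('a::{real_inner,banach} \<Rightarrow> real) \<Rightarrow> ('b::{real_inner,banach} \<Rightarrow> real)
    \<Rightarrow> ('a \<Rightarrow> 'z::{real_inner,banach}) \<Rightarrow> ('b \<Rightarrow> 'z) \<Rightarrow> 'z \<Rightarrow> ('a \<times> 'b) set" where
  "solution_set f g A B c =
    {(x, y). (x, y) \<in> feasible_set A B c \<and>
       (\<forall>(x', y') \<in> feasible_set A B c. objective f g x y \<le> objective f g x' y')}"

definition optimal_value ::
  "('a::{real_inner,banach} \<Rightarrow> real) \<Rightarrow> ('b::{real_inner,banach} \<Rightarrow> real)
    \<Rightarrow> ('a \<Rightarrow> 'z::{real_inner,banach}) \<Rightarrow> ('b \<Rightarrow> 'z) \<Rightarrow> 'z \<Rightarrow> real" where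
  "optimal_value f g A B c = (INF (x, y) \<in> feasible_set A B c. objective f g x y)"

definition lagrangian ::
  "('a::{real_inner,banach} \<Rightarrow> real) \<Rightarrow> ('b::{real_inner,banach} \<Rightarrow> real)
    \<Rightarrow> ('a \<Rightarrow> 'z::{real_inner,banach}) \<Rightarrow> ('b \<Rightarrow> 'z) \<Rightarrow> 'z \<Rightarrow> 'a \<Rightarrow> 'b \<Rightarrow> 'z \<Rightarrow> real" where
  "lagrangian f g A B c x y l = objective f g x y + l \<bullet> (A x + B y - c)"

definition aug_lagrangian ::
  "('a::{real_inner,banach} \<Rightarrow> real) \<Rightarrow> ('b::{real_inner,banach} \<Rightarrow> real)
    \<Rightarrow> ('a \<Rightarrow> 'z::{real_inner,banach}) \<Rightarrow> ('b \<Rightarrow> 'z) \<Rightarrow> 'z \<Rightarrow> real \<Rightarrow> 'a \<Rightarrow> 'b \<Rightarrow> 'z \<Rightarrow> real" where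
  "aug_lagrangian f g A B c \<mu> x y l =
    lagrangian f g A B c x y l + \<mu> / 2 * (norm (A x + B y - c))\<^sup>2"

definition saddle_points ::
  "('a::{real_inner,banach} \<Rightarrow> real) \<Rightarrow> ('b::{real_inner,banach} \<Rightarrow> real)
    \<Rightarrow> ('a \<Rightarrow> 'z::{real_inner,banach}) \<Rightarrow> ('b \<Rightarrow> 'z) \<Rightarrow> 'z \<Rightarrow> ('a \<times> 'b \<times> 'z) set" where
  "saddle_points f g A B c =
    {(xs, ys, ls). \<forall>x y l.
       lagrangian f g A B c xs ys l \<le> lagrangian f g A B c xs ys ls \<and>
       lagrangian f g A B c xs ys ls \<le> lagrangian f g A B c x y ls}"

(* Derivatives within S, hence one-sided at an endpoint of S. *)
definition C1_with_deriv ::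
  "(real \<Rightarrow> 'a::real_normed_vector) \<Rightarrow> (real \<Rightarrow> 'a) \<Rightarrow> real set \<Rightarrow> bool" where
  "C1_with_deriv u u' S \<longleftrightarrow>
    (\<forall>t\<in>S. (u has_vector_derivative u' t) (at t within S)) \<and> continuous_on S u'"

(* gf and gg are the gradients of f and g; x1, y1, l1 and x2, y2, l2 are the first and second
   derivatives of the trajectory (x, y, l). *)
definition trials_solution ::
  "('a::{real_inner,banach} \<Rightarrow> 'a) \<Rightarrow> ('b::{real_inner,banach} \<Rightarrow> 'b)
    \<Rightarrow> ('a \<Rightarrow> 'z::{real_inner,banach}) \<Rightarrow> ('b \<Rightarrow> 'z) \<Rightarrow> 'z \<Rightarrow> real
    \<Rightarrow> (real \<Rightarrow> real) \<Rightarrow> (real \<Rightarrow> real) \<Rightarrow> (real \<Rightarrow> real) \<Rightarrow> real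
    \<Rightarrow> (real \<Rightarrow> 'a) \<Rightarrow> (real \<Rightarrow> 'b) \<Rightarrow> (real \<Rightarrow> 'z)
    \<Rightarrow> (real \<Rightarrow> 'a) \<Rightarrow> (real \<Rightarrow> 'b) \<Rightarrow> (real \<Rightarrow> 'z)
    \<Rightarrow> (real \<Rightarrow> 'a) \<Rightarrow> (real \<Rightarrow> 'b) \<Rightarrow> (real \<Rightarrow> 'z) \<Rightarrow> bool" where
  "trials_solution gf gg A B c \<mu> \<gamma> \<alpha> b t0 x y l x1 y1 l1 x2 y2 l2 \<longleftrightarrow>
    C1_with_deriv x x1 {t0..} \<and> C1_with_deriv x1 x2 {t0..} \<and>
    C1_with_deriv y y1 {t0..} \<and> C1_with_deriv y1 y2 {t0..} \<and>
    C1_with_deriv l l1 {t0..} \<and> C1_with_deriv l1 l2 {t0..} \<and>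
    (\<forall>t\<ge>t0.
      x2 t + \<gamma> t *\<^sub>R x1 t
        + b t *\<^sub>R (gf (x t) + adjoint A (l t + \<alpha> t *\<^sub>R l1 t + \<mu> *\<^sub>R (A (x t) + B (y t) - c))) = 0 \<and>
      y2 t + \<gamma> t *\<^sub>R y1 t
        + b t *\<^sub>R (gg (y t) + adjoint B (l t + \<alpha> t *\<^sub>R l1 t + \<mu> *\<^sub>R (A (x t) + B (y t) - c))) = 0 \<and>
      l2 t + \<gamma> t *\<^sub>R l1 t
        - b t *\<^sub>R (A (x t + \<alpha> t *\<^sub>R x1 t) + B (y t + \<alpha> t *\<^sub>R y1 t) - c) = 0)"

(* w, w1 and ws stand for the trajectory, its derivative and the reference point in the product
   space; \<alpha>' and \<sigma>' are the derivatives of \<alpha> and \<sigma>. *)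
definition lyapunov ::
  "('a::{real_inner,banach} \<Rightarrow> real) \<Rightarrow> ('b::{real_inner,banach} \<Rightarrow> real)
    \<Rightarrow> ('a \<Rightarrow> 'z::{real_inner,banach}) \<Rightarrow> ('b \<Rightarrow> 'z) \<Rightarrow> 'z \<Rightarrow> real
    \<Rightarrow> (real \<Rightarrow> real) \<Rightarrow> (real \<Rightarrow> real) \<Rightarrow> (real \<Rightarrow> real) \<Rightarrow> (real \<Rightarrow> real) \<Rightarrow> (real \<Rightarrow> real) \<Rightarrow> (real \<Rightarrow> real)
    \<Rightarrow> (real \<Rightarrow> 'a \<times> 'b \<times> 'z) \<Rightarrow> (real \<Rightarrow> 'a \<times> 'b \<times> 'z) \<Rightarrow> 'a \<times> 'b \<times> 'z \<Rightarrow> real \<Rightarrow> real" where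
  "lyapunov f g A B c \<mu> \<gamma> \<alpha> \<alpha>' b \<sigma> \<sigma>' w w1 ws t =
    (let (x, y, _) = w t;
         (xs, ys, ls) = ws;
         \<delta> = \<sigma> t * \<alpha> t;
         \<xi> = (\<sigma> t)\<^sup>2 * (\<gamma> t * \<alpha> t - \<alpha>' t - 1) - 2 * \<alpha> t * \<sigma> t * \<sigma>' t;
         v = \<sigma> t *\<^sub>R (w t - ws) + \<delta> *\<^sub>R w1 t
     in \<delta>\<^sup>2 * b t * (aug_lagrangian f g A B c \<mu> x y ls - aug_lagrangian f g A B c \<mu> xs ys ls)
        + 1 / 2 * (norm v)\<^sup>2 + 1 / 2 * \<xi> * (norm (w t - ws))\<^sup>2)"

end

theory Submission
  imports Defs
begin

text \<open>The energy is a Lyapunov function.  It is the sum of a potential part, the augmented Lagrangian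
  gap with the weight \<open>\<alpha>\<^sup>2 * \<sigma>\<^sup>2 * b\<close>, and of an inertial part that measures the distance and the
  velocity of \<open>w = (x, y, l)\<close> relative to the reference point \<open>ws\<close>.

  The derivative of the inertial part contains no mixed term between position and velocity: up to the
  pairing of \<open>w - ws + \<alpha> *\<^sub>R w1\<close> with the force, it is a combination of \<open>(norm (w - ws))\<^sup>2\<close> and
  \<open>(norm w1)\<^sup>2\<close> whose coefficients are non-positive by \<open>G3\<close> and \<open>G2\<close> (lemma
  \<open>inertial_energy_has_derivative\<close>).  In the pairing, the extrapolation in the system makes the primal
  and the dual coupling cancel (\<open>force_pairing\<close>); this step moves \<open>A\<close> and \<open>B\<close> across the inner product
  and hence rests on the existence of adjoints, that is, on the Riesz representation theorem.  What
  remains of the force cancels the motion of the augmented Lagrangian, and by \<open>G4\<close> and convexity it also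
  absorbs the growth of the weight (\<open>energy_dissipation\<close>).  The energy therefore decreases at least at
  the rate \<open>\<mu> / 2 * \<alpha> * \<sigma>\<^sup>2 * b * (norm (A x + B y - c))\<^sup>2\<close> plus the viscous dissipation.

  By \<open>G1\<close> the inertial part is non-negative, so the weighted gap is bounded by the initial energy; this
  is the source of all rates.  At a saddle point the gap is non-negative too, so the energy stays
  non-negative, and a non-negative function dissipates only a finite total amount: this gives the two
  integrability claims (\<open>set_integrable_dissipation\<close>).\<close>

section \<open>Riesz representation and adjoints on Hilbert spaces\<close>

text \<open>The representing vector is the minimiser of \<open>v \<bullet> v - 2 * \<phi> v\<close>.  The parallelogram law makes
  every minimising sequence Cauchy, so that completeness provides the minimiser, and the first-order
  condition at the minimiser is the representation.\<close>

lemma Riesz_representation: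
  fixes \<phi> :: "'a::{real_inner,banach} \<Rightarrow> real"
  assumes "bounded_linear \<phi>"
  obtains u where "\<And>h. \<phi> h = h \<bullet> u"
proof -
  interpret bounded_linear \<phi> by fact
  define J where "J v = v \<bullet> v - 2 * \<phi> v" for v
  obtain K where K: "\<And>v. \<bar>\<phi> v\<bar> \<le> norm v * K"
    using bounded by auto
  have "- K\<^sup>2 \<le> J v" for v
  proof -
    have "\<phi> v \<le> norm v * K"
      using K[of v] by linarith
    moreover have "0 \<le> (norm v - K)\<^sup>2"
      by simp
    ultimately show ?thesis
      unfolding J_def power2_norm_eq_inner[symmetric] by (simp add: power2_diff)
  qed
  then have bdd: "bdd_below (range J)"
    by (auto intro!: bdd_belowI)
  define m where "m = Inf (range J)"
  have m_le: "m \<le> J v" for v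
    unfolding m_def using bdd by (intro cInf_lower) auto
  define \<epsilon> where "\<epsilon> n = inverse (real (Suc n))" for n
  have "\<exists>v. J v < m + \<epsilon> n" for n
  proof -
    have "Inf (range J) < m + \<epsilon> n"
      by (simp add: m_def \<epsilon>_def)
    from cInf_lessD[OF _ this] show ?thesis
      by auto
  qed
  then obtain X where X: "\<And>n. J (X n) < m + \<epsilon> n"
    by metis
  have parallelogram: "(norm (v - w))\<^sup>2 \<le> 2 * J v + 2 * J w - 4 * m" for v w
  proof -
    define z where "z = (1 / 2) *\<^sub>R (v + w)"
    have "(norm (v - w))\<^sup>2 = 2 * J v + 2 * J w - 4 * J z"
      unfolding J_def power2_norm_eq_inner z_def
      by (simp add: scaleR add inner_add_left inner_add_right inner_diff_left inner_diff_right
          inner_commute algebra_simps)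
    with m_le[of z] show ?thesis
      by linarith
  qed
  have "Cauchy X"
  proof (rule CauchyI)
    fix e :: real
    assume "0 < e"
    then obtain N where N: "\<epsilon> N < e\<^sup>2 / 4"
      using reals_Archimedean[of "e\<^sup>2 / 4"] by (auto simp: \<epsilon>_def)
    have "norm (X i - X j) < e" if "N \<le> i" "N \<le> j" for i j
    proof -
      have "\<epsilon> i \<le> \<epsilon> N"
        "\<epsilon> j \<le> \<epsilon> N"
        using that by (auto intro!: le_imp_inverse_le simp: \<epsilon>_def)
      with X[of i] X[of j] N parallelogram[of "X i" "X j"] have "(norm (X i - X j))\<^sup>2 < e\<^sup>2"
        by linarith
      then show ?thesis
        using \<open>0 < e\<close> by (intro power2_less_imp_less[of _ e]) auto
    qed
    then show "\<exists>M. \<forall>i\<ge>M. \<forall>j\<ge>M. norm (X i - X j) < e"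
      by blast
  qed
  then obtain u where u: "X \<longlonglongrightarrow> u"
    using Cauchy_convergent convergent_def by blast
  have "(\<lambda>n. J (X n)) \<longlonglongrightarrow> J u"
    unfolding J_def by (intro tendsto_intros tendsto u)
  moreover have "(\<lambda>n. m + \<epsilon> n) \<longlonglongrightarrow> m + 0"
    unfolding \<epsilon>_def by (intro tendsto_intros LIMSEQ_inverse_real_of_nat)
  ultimately have "J u \<le> m + 0"
    using X by (intro LIMSEQ_le[of "\<lambda>n. J (X n)" _ "\<lambda>n. m + \<epsilon> n"])
      (auto intro!: exI[of _ 0] less_imp_le)
  then have min: "J u \<le> J v" for v
    using m_le[of v] by linarith
  have "\<phi> h = h \<bullet> u" for h
  proof -
    define p q where "p = h \<bullet> u - \<phi> h" and "q = h \<bullet> h"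
    have "0 \<le> q"
      by (simp add: q_def)
    have expand: "J (u + s *\<^sub>R h) = J u + 2 * s * p + s\<^sup>2 * q" for s
      by (simp add: J_def p_def q_def add scaleR inner_add_left inner_add_right inner_commute
          power2_eq_square algebra_simps)
    \<comment> \<open>A step along \<open>h\<close>, short enough that the linear term dominates the quadratic one.\<close>
    define s where "s = - p / (q + 1)"
    have s: "p = - s * (q + 1)"
      using \<open>0 \<le> q\<close> by (simp add: s_def)
    have "0 \<le> 2 * s * p + s\<^sup>2 * q"
      using min[of "u + s *\<^sub>R h"] expand[of s] by linarith
    also have "\<dots> = - (s\<^sup>2 * (q + 2))"
      unfolding s by (simp add: power2_eq_square algebra_simps)
    finally have "s\<^sup>2 * (q + 2) \<le> 0"
      by simp
    then have "s = 0"
      using \<open>0 \<le> q\<close> by (auto simp: mult_le_0_iff)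
    then show ?thesis
      using s by (simp add: p_def)
  qed
  then show thesis
    using that by blast
qed

lemma inner_adjoint:
  fixes A :: "'a::{real_inner,banach} \<Rightarrow> 'z::real_inner"
  assumes "bounded_linear A"
  shows "v \<bullet> adjoint A z = A v \<bullet> z"
proof -
  have "\<exists>u. \<forall>v. A v \<bullet> z = v \<bullet> u" for z
    using Riesz_representation[OF bounded_linear_compose[OF bounded_linear_inner_left assms]]
    by metis
  then obtain A' where A': "\<forall>v z. A v \<bullet> z = v \<bullet> A' z"
    by metis
  then show ?thesis
    using adjoint_unique[OF A'] by simp
qed

section \<open>Convexity and differentiation along curves\<close>

lemma GDERIV_compose_has_real_derivative:
  assumes "GDERIV f (u t) :> d" and "(u has_vector_derivative u') (at t within S)"
  shows "((\<lambda>s. f (u s)) has_real_derivative d \<bullet> u') (at t within S)"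
proof -
  have "((\<lambda>s. f (u s)) has_derivative (\<lambda>s. (s *\<^sub>R u') \<bullet> d)) (at t within S)"
    using assms unfolding gderiv_def has_vector_derivative_def
    by (rule has_derivative_compose[rotated])
  then show ?thesis
    by (simp add: has_field_derivative_def inner_commute mult_commute_abs)
qed

lemma convex_above_tangent_gradient:
  fixes f :: "'a::real_inner \<Rightarrow> real"
  assumes "convex_on UNIV f" and "GDERIV f u :> d"
  shows "f u - f v \<le> (u - v) \<bullet> d"
proof -
  define \<phi> where "\<phi> s = f (u + s *\<^sub>R (v - u))" for s
  have "convex_on UNIV \<phi>"
  proof (rule convex_onI)
    fix t s r :: real
    assume t: "0 < t" "t < 1"
    have "u + ((1 - t) * s + t * r) *\<^sub>R (v - u)
        = (1 - t) *\<^sub>R (u + s *\<^sub>R (v - u)) + t *\<^sub>R (u + r *\<^sub>R (v - u))"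
      by (simp add: algebra_simps)
    then show "\<phi> ((1 - t) *\<^sub>R s + t *\<^sub>R r) \<le> (1 - t) * \<phi> s + t * \<phi> r"
      using convex_onD[OF assms(1), of t] t by (simp add: \<phi>_def)
  qed simp
  moreover have "((\<lambda>s. u + s *\<^sub>R (v - u)) has_vector_derivative (v - u)) (at 0)"
    by (auto intro!: derivative_eq_intros)
  then have "(\<phi> has_real_derivative d \<bullet> (v - u)) (at 0)"
    unfolding \<phi>_def using assms(2) by (intro GDERIV_compose_has_real_derivative) auto
  ultimately have "d \<bullet> (v - u) * (1 - 0) \<le> \<phi> 1 - \<phi> 0"
    by (intro convex_on_imp_above_tangent[of UNIV]) auto
  then show ?thesis
    by (simp add: \<phi>_def inner_diff_left inner_diff_right inner_commute)
qed

section \<open>Dissipation on a half-line\<close>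

lemma antimono_on_if_deriv_nonpos:
  fixes E :: "real \<Rightarrow> real"
  assumes deriv: "\<And>t. a \<le> t \<Longrightarrow> (E has_real_derivative E' t) (at t within {a..})"
    and nonpos: "\<And>t. a \<le> t \<Longrightarrow> E' t \<le> 0"
  shows "antimono_on {a..} E"
proof (rule monotone_onI)
  fix s t
  assume "s \<in> {a..}" "t \<in> {a..}" "s \<le> t"
  show "E t \<le> E s"
  proof (cases "s = t")
    case False
    with \<open>s \<le> t\<close> have "s < t"
      by simp
    have "(E has_derivative (*) (E' r)) (at r within {s..t})" if "s \<le> r" "r \<le> t" for r
      using deriv[of r] that \<open>s \<in> {a..}\<close> unfolding has_field_derivative_def
      by (auto intro: has_derivative_subset)
    from mvt_simple[OF \<open>s < t\<close> this] obtain r where r: "r \<in> {s<..<t}" "E t - E s = E' r * (t - s)"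
      by blast
    have "E' r * (t - s) \<le> 0"
      using r nonpos[of r] \<open>s \<in> {a..}\<close> \<open>s < t\<close> by (intro mult_nonpos_nonneg) auto
    with r show ?thesis
      by linarith
  qed simp
qed

text \<open>Any antiderivative \<open>H\<close> of \<open>h\<close> makes \<open>E + H\<close> non-increasing; since \<open>E\<close> stays non-negative, \<open>H\<close> is
  bounded, and this bounds the integral of \<open>h\<close>.\<close>

lemma set_integrable_dissipation:
  fixes E h :: "real \<Rightarrow> real"
  assumes deriv: "\<And>t. a \<le> t \<Longrightarrow> (E has_real_derivative E' t) (at t within {a..})"
    and E_nonneg: "\<And>t. a \<le> t \<Longrightarrow> 0 \<le> E t"
    and cont: "continuous_on {a..} h"
    and h_nonneg: "\<And>t. a \<le> t \<Longrightarrow> 0 \<le> h t"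
    and dissipation: "\<And>t. a \<le> t \<Longrightarrow> E' t \<le> - h t"
  shows "set_integrable lborel {a..} h"
proof -
  \<comment> \<open>Freezing \<open>h\<close> to the left of \<open>a\<close> turns one-sided derivatives at \<open>a\<close> into two-sided ones.\<close>
  define k where "k t = h (max a t)" for t
  have k_cont: "continuous_on UNIV k"
    unfolding k_def by (rule continuous_on_compose2[OF cont]) (auto intro!: continuous_intros)
  have k_eq: "k t = h t" if "a \<le> t" for t
    using that by (simp add: k_def max_def)
  have k_nonneg: "0 \<le> k t" for t
    unfolding k_def by (intro h_nonneg) auto
  have "\<exists>H. \<forall>t::real. -\<infinity> < ereal t \<longrightarrow> ereal t < \<infinity> \<longrightarrow> (H has_vector_derivative k t) (at t)"
    using k_cont by (intro einterval_antiderivative) (auto simp: continuous_on_eq_continuous_at)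
  then obtain H where H: "\<And>t. (H has_real_derivative k t) (at t)"
    by (auto simp: has_real_derivative_iff_has_vector_derivative)
  have H_mono: "mono H"
    by (rule monoI, rule DERIV_nonneg_imp_nondecreasing) (use H k_nonneg in blast)+
  have "antimono_on {a..} (\<lambda>t. E t + H t)"
  proof (rule antimono_on_if_deriv_nonpos)
    fix t
    assume "a \<le> t"
    then show "((\<lambda>t. E t + H t) has_real_derivative E' t + h t) (at t within {a..})"
      using DERIV_subset[OF H[of t], of "{a..}"] k_eq[of t]
      by (intro DERIV_add deriv) auto
    show "E' t + h t \<le> 0"
      using dissipation[OF \<open>a \<le> t\<close>] by simp
  qed
  then have H_le: "H t \<le> E a + H a" if "a \<le> t" for t
    using monotone_onD[of "{a..}" "(\<le>)" "(\<ge>)" "\<lambda>t. E t + H t" a t] E_nonneg[of t] that by auto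
  have H_bdd: "H t \<le> E a + H a" for t
    using H_le[of t] monoD[OF H_mono, of t a] E_nonneg[of a] by (cases "a \<le> t") auto
  define T where "T = (SUP t. H t)"
  have lim: "(H \<longlongrightarrow> T) at_top"
  proof (rule increasing_tendsto)
    show "\<forall>\<^sub>F t in at_top. H t \<le> T"
      unfolding T_def using H_bdd by (intro always_eventually allI cSUP_upper bdd_aboveI2) auto
    fix y
    assume "y < T"
    then obtain s where "y < H s"
      unfolding T_def using H_bdd by (subst (asm) less_cSUP_iff) (auto intro!: bdd_aboveI2)
    then show "\<forall>\<^sub>F t in at_top. y < H t"
      using monoD[OF H_mono] by (intro eventually_at_top_linorderI[of s]) (meson less_le_trans)
  qed
  have k_meas: "k \<in> borel_measurable borel"
    by (rule borel_measurable_continuous_onI[OF k_cont])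
  have "(\<integral>\<^sup>+t. ennreal (k t) * indicator {a..} t \<partial>lborel) = ennreal (T - H a)"
    using H k_nonneg lim by (intro nn_integral_FTC_atLeast k_meas) auto
  moreover have "ennreal (k t) * indicator {a..} t = ennreal (indicator {a..} t *\<^sub>R k t)" for t
    by (simp split: split_indicator)
  ultimately have "set_integrable lborel {a..} k"
    unfolding set_integrable_def using k_meas k_nonneg
    by (intro integrableI_nonneg) (auto simp: less_top[symmetric])
  then show ?thesis
    by (rule set_integrable_cong[THEN iffD1, rotated -1]) (auto simp: k_eq)
qed

section \<open>Energy of a damped inertial motion\<close>

text \<open>The weight \<open>\<xi>\<close> in front of \<open>(norm (w - ws))\<^sup>2\<close> is exactly what removes the mixed term
  \<open>(w - ws) \<bullet> w1\<close> from the derivative, whatever the force \<open>w2 + \<gamma> *\<^sub>R w1\<close> is.  Since \<open>\<xi> = H - \<sigma>\<^sup>2\<close>,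
  differentiability of \<open>H\<close> replaces that of \<open>\<sigma>'\<close>, and the \<open>\<sigma> * \<sigma>'\<close> coming from \<open>\<sigma>\<^sup>2\<close> cancels the one
  coming from \<open>v\<close>.\<close>

lemma inertial_energy_has_derivative:
  fixes w w1 :: "real \<Rightarrow> 'w::real_inner" and ws w2 :: 'w and \<gamma> \<alpha> \<alpha>' \<sigma> \<sigma>' :: "real \<Rightarrow> real"
  defines "H \<equiv> \<lambda>s. \<sigma> s * (\<sigma> s * (\<gamma> s * \<alpha> s - \<alpha>' s) - 2 * \<alpha> s * \<sigma>' s)"
    and "\<xi> \<equiv> \<lambda>s. (\<sigma> s)\<^sup>2 * (\<gamma> s * \<alpha> s - \<alpha>' s - 1) - 2 * \<alpha> s * \<sigma> s * \<sigma>' s"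
    and "v \<equiv> \<lambda>s. \<sigma> s *\<^sub>R (w s - ws) + (\<sigma> s * \<alpha> s) *\<^sub>R w1 s"
  assumes w: "(w has_vector_derivative w1 t) (at t within S)"
    and w1: "(w1 has_vector_derivative w2) (at t within S)"
    and \<alpha>: "(\<alpha> has_real_derivative \<alpha>' t) (at t within S)"
    and \<sigma>: "(\<sigma> has_real_derivative \<sigma>' t) (at t within S)"
    and H: "(H has_real_derivative H') (at t within S)"
  shows "((\<lambda>s. 1 / 2 * (norm (v s))\<^sup>2 + 1 / 2 * \<xi> s * (norm (w s - ws))\<^sup>2) has_real_derivative
      1 / 2 * H' * (norm (w t - ws))\<^sup>2
      - \<alpha> t * \<sigma> t * (\<sigma> t * (\<gamma> t * \<alpha> t - \<alpha>' t - 1) - \<alpha> t * \<sigma>' t) * (norm (w1 t))\<^sup>2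
      + (\<sigma> t)\<^sup>2 * \<alpha> t * ((w t - ws + \<alpha> t *\<^sub>R w1 t) \<bullet> (w2 + \<gamma> t *\<^sub>R w1 t))) (at t within S)"
proof -
  have norm_deriv: "((\<lambda>s. (norm (u s))\<^sup>2) has_real_derivative 2 * (u t \<bullet> u')) (at t within S)"
    if "(u has_vector_derivative u') (at t within S)" for u :: "real \<Rightarrow> 'w" and u'
    using bounded_bilinear.has_vector_derivative[OF bounded_bilinear_inner that that]
    by (simp add: power2_norm_eq_inner inner_commute has_real_derivative_iff_has_vector_derivative)
  have W: "((\<lambda>s. w s - ws) has_vector_derivative w1 t) (at t within S)"
    using w by (auto intro!: derivative_eq_intros)
  have \<sigma>\<alpha>: "((\<lambda>s. \<sigma> s * \<alpha> s) has_real_derivative \<sigma>' t * \<alpha> t + \<sigma> t * \<alpha>' t) (at t within S)"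
    using \<sigma> \<alpha> by (auto intro!: derivative_eq_intros)
  have v: "(v has_vector_derivative
      (\<sigma> t *\<^sub>R w1 t + \<sigma>' t *\<^sub>R (w t - ws))
      + ((\<sigma> t * \<alpha> t) *\<^sub>R w2 + (\<sigma>' t * \<alpha> t + \<sigma> t * \<alpha>' t) *\<^sub>R w1 t)) (at t within S)"
    unfolding v_def
    by (intro has_vector_derivative_add has_vector_derivative_scaleR W w1 \<sigma> \<sigma>\<alpha>)
  have \<xi>_eq: "\<xi> = (\<lambda>s. H s - (\<sigma> s)\<^sup>2)"
    by (auto simp: \<xi>_def H_def power2_eq_square algebra_simps)
  have \<xi>: "(\<xi> has_real_derivative H' - 2 * \<sigma> t * \<sigma>' t) (at t within S)"
    unfolding \<xi>_eq using H \<sigma> by (auto intro!: derivative_eq_intros)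
  define W where "W = w t - ws"
  have "((\<lambda>s. 1 / 2 * (norm (v s))\<^sup>2 + 1 / 2 * \<xi> s * (norm (w s - ws))\<^sup>2) has_real_derivative
      1 / 2 * (2 * (v t \<bullet> ((\<sigma> t *\<^sub>R w1 t + \<sigma>' t *\<^sub>R (w t - ws))
        + ((\<sigma> t * \<alpha> t) *\<^sub>R w2 + (\<sigma>' t * \<alpha> t + \<sigma> t * \<alpha>' t) *\<^sub>R w1 t))))
      + (1 / 2 * (H' - 2 * \<sigma> t * \<sigma>' t) * (norm (w t - ws))\<^sup>2
         + 2 * ((w t - ws) \<bullet> w1 t) * (1 / 2 * \<xi> t))) (at t within S)"
    by (intro DERIV_add DERIV_mult DERIV_cmult norm_deriv v W \<xi>)
  then show ?thesis
    unfolding W_def[symmetric] \<xi>_def v_def power2_norm_eq_inner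
    by (rule DERIV_cong) (simp add: inner_add_left inner_add_right
        inner_commute power2_eq_square algebra_simps)
qed

section \<open>Lagrangian duality\<close>

text \<open>The Lagrangian is affine in the multiplier, so it can only be bounded above if the residual
  vanishes; on the feasible set it coincides with the objective.\<close>

lemma saddle_point_imp_solution:
  assumes "(xs, ys, ls) \<in> saddle_points f g A B c"
  shows "(xs, ys) \<in> solution_set f g A B c"
proof -
  let ?r = "A xs + B ys - c"
  have dual: "lagrangian f g A B c xs ys l \<le> lagrangian f g A B c xs ys ls" for l
    using assms by (auto simp: saddle_points_def)
  have primal: "lagrangian f g A B c xs ys ls \<le> lagrangian f g A B c x y ls" for x y
    using assms by (auto simp: saddle_points_def)
  have "?r \<bullet> ?r \<le> 0"
    using dual[of "ls + ?r"] by (simp add: lagrangian_def inner_add_left)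
  then have "?r = 0"
    using inner_ge_zero[of ?r] by (metis antisym inner_eq_zero_iff)
  then have "objective f g xs ys \<le> objective f g x y" if "A x + B y = c" for x y
    using primal[of x y] that by (simp add: lagrangian_def)
  with \<open>?r = 0\<close> show ?thesis
    by (auto simp: solution_set_def feasible_set_def)
qed

lemma optimal_value_eq:
  assumes "(xs, ys) \<in> solution_set f g A B c"
  shows "optimal_value f g A B c = objective f g xs ys"
  unfolding optimal_value_def
  using assms by (intro cInf_eq_minimum) (force simp: solution_set_def)+

lemma aug_lagrangian_feasible:
  assumes "(xs, ys) \<in> solution_set f g A B c"
  shows "aug_lagrangian f g A B c \<mu> xs ys l = objective f g xs ys"
  using assms
  by (auto simp: aug_lagrangian_def lagrangian_def solution_set_def feasible_set_def)

lemma C1_with_deriv_imp_continuous: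
  assumes "C1_with_deriv u u' S"
  shows "continuous_on S u" and "continuous_on S u'"
  using assms by (auto simp: C1_with_deriv_def intro: continuous_on_vector_derivative)

lemma has_real_derivative_imp_continuous_on:
  assumes "\<And>t. t \<in> S \<Longrightarrow> (h has_real_derivative h' t) (at t within S)"
  shows "continuous_on S h"
  unfolding continuous_on_eq_continuous_within using assms DERIV_continuous by blast

section \<open>The energy along a trajectory\<close>

locale trials_trajectory =
  fixes f :: "'a::{real_inner,banach} \<Rightarrow> real" and gf :: "'a \<Rightarrow> 'a"
    and g :: "'b::{real_inner,banach} \<Rightarrow> real" and gg :: "'b \<Rightarrow> 'b"
    and A :: "'a \<Rightarrow> 'z::{real_inner,banach}" and B :: "'b \<Rightarrow> 'z" and c :: 'z
    and \<mu> t0 :: real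
    and \<gamma> \<alpha> \<alpha>' b \<sigma> \<sigma>' G3' G4' :: "real \<Rightarrow> real"
    and x x1 x2 :: "real \<Rightarrow> 'a" and y y1 y2 :: "real \<Rightarrow> 'b" and l l1 l2 :: "real \<Rightarrow> 'z"
  assumes f_convex: "convex_on UNIV f" and f_grad: "\<And>u. GDERIV f u :> gf u"
    and g_convex: "convex_on UNIV g" and g_grad: "\<And>u. GDERIV g u :> gg u"
    and A: "bounded_linear A" and B: "bounded_linear B"
    and \<mu>: "\<mu> > 0"
    and \<gamma>_cont: "continuous_on {t0..} \<gamma>"
    and \<alpha>_C1: "C1_with_deriv \<alpha> \<alpha>' {t0..}" and \<alpha>_nonneg: "\<And>t. t \<ge> t0 \<Longrightarrow> \<alpha> t \<ge> 0"
    and b_cont: "continuous_on {t0..} b" and b_nonneg: "\<And>t. t \<ge> t0 \<Longrightarrow> b t \<ge> 0"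
    and \<sigma>_deriv: "\<And>t. t \<ge> t0 \<Longrightarrow> (\<sigma> has_real_derivative \<sigma>' t) (at t within {t0..})"
    and \<sigma>_nonneg: "\<And>t. t \<ge> t0 \<Longrightarrow> \<sigma> t \<ge> 0"
    and G1: "\<And>t. t \<ge> t0 \<Longrightarrow> \<sigma> t * (\<gamma> t * \<alpha> t - \<alpha>' t - 1) - 2 * \<alpha> t * \<sigma>' t \<ge> 0"
    and G2: "\<And>t. t \<ge> t0 \<Longrightarrow> \<sigma> t * (\<gamma> t * \<alpha> t - \<alpha>' t - 1) - \<alpha> t * \<sigma>' t \<ge> 0"
    and G3_deriv: "\<And>t. t \<ge> t0 \<Longrightarrow>
      ((\<lambda>s. \<sigma> s * (\<sigma> s * (\<gamma> s * \<alpha> s - \<alpha>' s) - 2 * \<alpha> s * \<sigma>' s)) has_real_derivative G3' t)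
        (at t within {t0..})"
    and G3: "\<And>t. t \<ge> t0 \<Longrightarrow> - G3' t \<ge> 0"
    and G4_deriv: "\<And>t. t \<ge> t0 \<Longrightarrow>
      ((\<lambda>s. (\<alpha> s)\<^sup>2 * (\<sigma> s)\<^sup>2 * b s) has_real_derivative G4' t) (at t within {t0..})"
    and G4: "\<And>t. t \<ge> t0 \<Longrightarrow> \<alpha> t * (\<sigma> t)\<^sup>2 * b t - G4' t = 0"
    and trials: "trials_solution gf gg A B c \<mu> \<gamma> \<alpha> b t0 x y l x1 y1 l1 x2 y2 l2"
begin

abbreviation residual :: "real \<Rightarrow> 'z" where
  "residual t \<equiv> A (x t) + B (y t) - c"

abbreviation weight :: "real \<Rightarrow> real" where
  "weight t \<equiv> (\<alpha> t)\<^sup>2 * (\<sigma> t)\<^sup>2 * b t"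

abbreviation viscosity :: "real \<Rightarrow> real" where
  "viscosity t \<equiv> \<alpha> t * \<sigma> t * (\<sigma> t * (\<gamma> t * \<alpha> t - \<alpha>' t - 1) - \<alpha> t * \<sigma>' t)"

abbreviation energy :: "'a \<Rightarrow> 'b \<Rightarrow> 'z \<Rightarrow> real \<Rightarrow> real" where
  "energy xs ys ls \<equiv> lyapunov f g A B c \<mu> \<gamma> \<alpha> \<alpha>' b \<sigma> \<sigma>'
    (\<lambda>t. (x t, y t, l t)) (\<lambda>t. (x1 t, y1 t, l1 t)) (xs, ys, ls)"

abbreviation aug_velocity :: "'z \<Rightarrow> real \<Rightarrow> real" where
  "aug_velocity ls t \<equiv> gf (x t) \<bullet> x1 t + gg (y t) \<bullet> y1 t
    + (ls + \<mu> *\<^sub>R residual t) \<bullet> (A (x1 t) + B (y1 t))"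

lemma trajectory_derivatives:
  assumes "t0 \<le> t"
  shows "(x has_vector_derivative x1 t) (at t within {t0..})"
    and "(y has_vector_derivative y1 t) (at t within {t0..})"
    and "(l has_vector_derivative l1 t) (at t within {t0..})"
    and "(x1 has_vector_derivative x2 t) (at t within {t0..})"
    and "(y1 has_vector_derivative y2 t) (at t within {t0..})"
    and "(l1 has_vector_derivative l2 t) (at t within {t0..})"
  using trials assms by (auto simp: trials_solution_def C1_with_deriv_def)

lemma aug_lagrangian_has_derivative:
  assumes "t0 \<le> t"
  shows "((\<lambda>s. aug_lagrangian f g A B c \<mu> (x s) (y s) ls) has_real_derivative aug_velocity ls t)
    (at t within {t0..})"
proof -
  have r: "(residual has_vector_derivative A (x1 t) + B (y1 t)) (at t within {t0..})"
    using trajectory_derivatives[OF assms]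
    by (auto intro!: derivative_eq_intros bounded_linear.has_vector_derivative[OF A]
        bounded_linear.has_vector_derivative[OF B])
  have linear: "((\<lambda>s. ls \<bullet> residual s) has_real_derivative ls \<bullet> (A (x1 t) + B (y1 t)))
      (at t within {t0..})"
    using bounded_linear.has_vector_derivative[OF bounded_linear_inner_right r]
    by (simp add: has_real_derivative_iff_has_vector_derivative)
  have square: "((\<lambda>s. (norm (residual s))\<^sup>2) has_real_derivative
      2 * (residual t \<bullet> (A (x1 t) + B (y1 t)))) (at t within {t0..})"
    using bounded_bilinear.has_vector_derivative[OF bounded_bilinear_inner r r]
    by (simp add: power2_norm_eq_inner inner_commute has_real_derivative_iff_has_vector_derivative)
  have "((\<lambda>s. aug_lagrangian f g A B c \<mu> (x s) (y s) ls) has_real_derivative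
      gf (x t) \<bullet> x1 t + gg (y t) \<bullet> y1 t + ls \<bullet> (A (x1 t) + B (y1 t))
      + \<mu> / 2 * (2 * (residual t \<bullet> (A (x1 t) + B (y1 t))))) (at t within {t0..})"
    unfolding aug_lagrangian_def lagrangian_def objective_def
    by (intro DERIV_add DERIV_cmult linear square GDERIV_compose_has_real_derivative
        f_grad g_grad trajectory_derivatives assms)
  then show ?thesis
    by (rule DERIV_cong) (simp add: inner_add_left)
qed

text \<open>The extrapolated points \<open>l + \<alpha> *\<^sub>R l1\<close> and \<open>x + \<alpha> *\<^sub>R x1\<close>, \<open>y + \<alpha> *\<^sub>R y1\<close> of the system are chosen so
  that, tested against \<open>w - ws + \<alpha> *\<^sub>R w1\<close>, the primal and the dual coupling terms cancel: only the
  reference multiplier \<open>ls\<close> survives, and the velocities appear through \<open>aug_velocity\<close> alone.\<close>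

lemma force_pairing:
  assumes "t0 \<le> t" and feasible: "A xs + B ys = c"
  shows "((x t, y t, l t) - (xs, ys, ls) + \<alpha> t *\<^sub>R (x1 t, y1 t, l1 t))
      \<bullet> ((x2 t, y2 t, l2 t) + \<gamma> t *\<^sub>R (x1 t, y1 t, l1 t))
    = - b t * ((x t - xs) \<bullet> gf (x t) + (y t - ys) \<bullet> gg (y t)
        + (ls + \<mu> *\<^sub>R residual t) \<bullet> residual t + \<alpha> t * aug_velocity ls t)"
proof -
  interpret A: bounded_linear A by (rule A)
  interpret B: bounded_linear B by (rule B)
  define p where "p = l t + \<alpha> t *\<^sub>R l1 t + \<mu> *\<^sub>R residual t"
  have forces: "x2 t + \<gamma> t *\<^sub>R x1 t = - b t *\<^sub>R (gf (x t) + adjoint A p)"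
    "y2 t + \<gamma> t *\<^sub>R y1 t = - b t *\<^sub>R (gg (y t) + adjoint B p)"
    "l2 t + \<gamma> t *\<^sub>R l1 t = b t *\<^sub>R (residual t + \<alpha> t *\<^sub>R (A (x1 t) + B (y1 t)))"
    using trials assms(1)
    by (auto simp: trials_solution_def p_def eq_neg_iff_add_eq_0 A.add A.scaleR B.add B.scaleR
        algebra_simps)
  have primal: "(x t - xs + \<alpha> t *\<^sub>R x1 t) \<bullet> adjoint A p + (y t - ys + \<alpha> t *\<^sub>R y1 t) \<bullet> adjoint B p
      = (residual t + \<alpha> t *\<^sub>R (A (x1 t) + B (y1 t))) \<bullet> p"
    unfolding inner_adjoint[OF A] inner_adjoint[OF B] inner_add_left[symmetric]
    by (simp add: feasible[symmetric] A.add A.diff A.scaleR B.add B.diff B.scaleR algebra_simps)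
  define X Y e where "X = x t - xs + \<alpha> t *\<^sub>R x1 t" and "Y = y t - ys + \<alpha> t *\<^sub>R y1 t"
    and "e = residual t + \<alpha> t *\<^sub>R (A (x1 t) + B (y1 t))"
  have "((x t, y t, l t) - (xs, ys, ls) + \<alpha> t *\<^sub>R (x1 t, y1 t, l1 t))
      \<bullet> ((x2 t, y2 t, l2 t) + \<gamma> t *\<^sub>R (x1 t, y1 t, l1 t))
    = X \<bullet> (- b t *\<^sub>R (gf (x t) + adjoint A p)) + (Y \<bullet> (- b t *\<^sub>R (gg (y t) + adjoint B p))
      + (l t - ls + \<alpha> t *\<^sub>R l1 t) \<bullet> (b t *\<^sub>R e))"
    by (simp add: forces X_def Y_def e_def)
  also have "\<dots> = - b t * (X \<bullet> gf (x t) + Y \<bullet> gg (y t) + (X \<bullet> adjoint A p + Y \<bullet> adjoint B p)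
      - (l t - ls + \<alpha> t *\<^sub>R l1 t) \<bullet> e)"
    by (simp add: inner_add_right algebra_simps)
  also have "X \<bullet> adjoint A p + Y \<bullet> adjoint B p = e \<bullet> p"
    using primal by (simp add: X_def Y_def e_def)
  also have "X \<bullet> gf (x t) + Y \<bullet> gg (y t) + e \<bullet> p - (l t - ls + \<alpha> t *\<^sub>R l1 t) \<bullet> e
      = X \<bullet> gf (x t) + Y \<bullet> gg (y t) + (ls + \<mu> *\<^sub>R residual t) \<bullet> e"
    by (simp add: p_def inner_add_left inner_add_right inner_diff_left inner_commute[of e])
  also have "\<dots> = (x t - xs) \<bullet> gf (x t) + (y t - ys) \<bullet> gg (y t)
      + (ls + \<mu> *\<^sub>R residual t) \<bullet> residual t + \<alpha> t * aug_velocity ls t"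
    unfolding X_def Y_def e_def inner_add_left[of "x t - xs"] inner_add_left[of "y t - ys"]
      inner_add_right[of _ "residual t"]
    by (simp add: inner_commute[of "x1 t"] inner_commute[of "y1 t"] distrib_left)
  finally show ?thesis .
qed

text \<open>The penalty is quadratic in the residual, hence the first-order bound at the current point
  exceeds the gap by at least \<open>\<mu> / 2 * (norm (residual t))\<^sup>2\<close>.  This surplus is what makes the residual
  integrable.\<close>

lemma aug_lagrangian_gap_le:
  assumes feasible: "A xs + B ys = c"
  shows "aug_lagrangian f g A B c \<mu> (x t) (y t) ls - aug_lagrangian f g A B c \<mu> xs ys ls
      + \<mu> / 2 * (norm (residual t))\<^sup>2
    \<le> (x t - xs) \<bullet> gf (x t) + (y t - ys) \<bullet> gg (y t) + (ls + \<mu> *\<^sub>R residual t) \<bullet> residual t"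
  using convex_above_tangent_gradient[OF f_convex f_grad, of "x t" xs]
    convex_above_tangent_gradient[OF g_convex g_grad, of "y t" ys]
  by (simp add: aug_lagrangian_def lagrangian_def objective_def feasible inner_add_left
      power2_norm_eq_inner)

lemma energy_eq:
  "energy xs ys ls t =
    weight t * (aug_lagrangian f g A B c \<mu> (x t) (y t) ls - aug_lagrangian f g A B c \<mu> xs ys ls)
    + (1 / 2 * (norm (\<sigma> t *\<^sub>R ((x t, y t, l t) - (xs, ys, ls))
          + (\<sigma> t * \<alpha> t) *\<^sub>R (x1 t, y1 t, l1 t)))\<^sup>2
      + 1 / 2 * ((\<sigma> t)\<^sup>2 * (\<gamma> t * \<alpha> t - \<alpha>' t - 1) - 2 * \<alpha> t * \<sigma> t * \<sigma>' t)
        * (norm ((x t, y t, l t) - (xs, ys, ls)))\<^sup>2)"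
  unfolding lyapunov_def Let_def
  by (simp only: prod.case) (simp add: power_mult_distrib mult.commute[of "(\<sigma> t)\<^sup>2"])

text \<open>After the substitution of the forces, the \<open>aug_velocity\<close> terms cancel because the potential
  carries the weight \<open>(\<sigma> * \<alpha>)\<^sup>2 * b\<close>.  By \<open>G4\<close> this weight grows at the rate \<open>\<alpha> * \<sigma>\<^sup>2 * b\<close>, so the
  potential gap that its growth produces is absorbed by the convexity estimate
  \<open>aug_lagrangian_gap_le\<close>, whose surplus is left over as dissipation.\<close>

lemma energy_dissipation_at:
  assumes "t0 \<le> t" and feasible: "A xs + B ys = c"
  obtains D where "(energy xs ys ls has_real_derivative D) (at t within {t0..})"
    and "D \<le> - (\<mu> / 2 * (\<alpha> t * (\<sigma> t)\<^sup>2 * b t * (norm (residual t))\<^sup>2)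
      + viscosity t * (norm (x1 t, y1 t, l1 t))\<^sup>2)"
proof -
  define gap where "gap s =
    aug_lagrangian f g A B c \<mu> (x s) (y s) ls - aug_lagrangian f g A B c \<mu> xs ys ls" for s
  define Q where "Q = (x t - xs) \<bullet> gf (x t) + (y t - ys) \<bullet> gg (y t)
    + (ls + \<mu> *\<^sub>R residual t) \<bullet> residual t"
  define V where "V = aug_velocity ls t"
  define n where "n = (norm ((x t, y t, l t) - (xs, ys, ls)))\<^sup>2"
  define u where "u = viscosity t * (norm (x1 t, y1 t, l1 t))\<^sup>2"
  have gap: "(gap has_real_derivative V) (at t within {t0..})"
    unfolding gap_def V_def using DERIV_diff[OF aug_lagrangian_has_derivative DERIV_const] assms(1)
    by simp
  have w: "((\<lambda>s. (x s, y s, l s)) has_vector_derivative (x1 t, y1 t, l1 t)) (at t within {t0..})"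
    and w1: "((\<lambda>s. (x1 s, y1 s, l1 s)) has_vector_derivative (x2 t, y2 t, l2 t)) (at t within {t0..})"
    by (intro has_vector_derivative_Pair trajectory_derivatives assms)+
  have \<alpha>: "(\<alpha> has_real_derivative \<alpha>' t) (at t within {t0..})"
    using \<alpha>_C1 assms(1)
    by (simp add: C1_with_deriv_def has_real_derivative_iff_has_vector_derivative)
  have "(energy xs ys ls has_real_derivative G4' t * gap t + V * weight t
      + (1 / 2 * G3' t * n - u + (\<sigma> t)\<^sup>2 * \<alpha> t * (- b t * (Q + \<alpha> t * V)))) (at t within {t0..})"
    unfolding energy_eq gap_def[symmetric] n_def u_def Q_def V_def force_pairing[OF assms, symmetric]
    unfolding V_def[symmetric]
    by (intro DERIV_add DERIV_mult G4_deriv gap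
        inertial_energy_has_derivative[OF w w1 \<alpha> \<sigma>_deriv G3_deriv] assms)
  moreover have "G4' t * gap t + V * weight t
      + (1 / 2 * G3' t * n - u + (\<sigma> t)\<^sup>2 * \<alpha> t * (- b t * (Q + \<alpha> t * V)))
    \<le> - (\<mu> / 2 * (\<alpha> t * (\<sigma> t)\<^sup>2 * b t * (norm (residual t))\<^sup>2) + u)"
  proof -
    define q where "q = \<alpha> t * (\<sigma> t)\<^sup>2 * b t"
    have "q * (gap t + \<mu> / 2 * (norm (residual t))\<^sup>2) \<le> q * Q"
      unfolding q_def gap_def Q_def
      by (intro mult_left_mono aug_lagrangian_gap_le feasible mult_nonneg_nonneg \<alpha>_nonneg b_nonneg
          assms) simp
    then have convexity: "q * gap t + \<mu> / 2 * (q * (norm (residual t))\<^sup>2) \<le> q * Q"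
      by (simp add: distrib_left mult.left_commute)
    have "G3' t * n \<le> 0"
      using G3[OF assms(1)] by (intro mult_nonpos_nonneg) (auto simp: n_def)
    moreover have "G4' t = q"
      using G4[OF assms(1)] by (simp add: q_def)
    then have "G4' t * gap t + V * weight t
        + (1 / 2 * G3' t * n - u + (\<sigma> t)\<^sup>2 * \<alpha> t * (- b t * (Q + \<alpha> t * V)))
      = q * gap t - q * Q - u + 1 / 2 * (G3' t * n)"
      by (simp add: q_def power2_eq_square algebra_simps)
    ultimately show ?thesis
      unfolding q_def[symmetric] using convexity by linarith
  qed
  ultimately show thesis
    using that unfolding u_def by blast
qed

lemma residual_dissipation_nonneg:
  "t0 \<le> t \<Longrightarrow> 0 \<le> \<alpha> t * (\<sigma> t)\<^sup>2 * b t * (norm (residual t))\<^sup>2"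
  by (intro mult_nonneg_nonneg \<alpha>_nonneg b_nonneg) auto

lemma viscous_dissipation_nonneg:
  "t0 \<le> t \<Longrightarrow> 0 \<le> viscosity t * (norm (x1 t, y1 t, l1 t))\<^sup>2"
  by (intro mult_nonneg_nonneg \<alpha>_nonneg \<sigma>_nonneg G2) auto

lemma energy_dissipation:
  assumes "A xs + B ys = c"
  obtains D where "\<And>t. t0 \<le> t \<Longrightarrow> (energy xs ys ls has_real_derivative D t) (at t within {t0..})"
    and "\<And>t. t0 \<le> t \<Longrightarrow> D t \<le> - (\<mu> / 2 * (\<alpha> t * (\<sigma> t)\<^sup>2 * b t * (norm (residual t))\<^sup>2))"
    and "\<And>t. t0 \<le> t \<Longrightarrow> D t \<le> - (viscosity t * (norm (x1 t, y1 t, l1 t))\<^sup>2)"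
    and "\<And>t. t0 \<le> t \<Longrightarrow> D t \<le> 0"
proof -
  define r where "r t = \<mu> / 2 * (\<alpha> t * (\<sigma> t)\<^sup>2 * b t * (norm (residual t))\<^sup>2)" for t
  define v where "v t = viscosity t * (norm (x1 t, y1 t, l1 t))\<^sup>2" for t
  have "\<forall>t. \<exists>D. t0 \<le> t \<longrightarrow>
      (energy xs ys ls has_real_derivative D) (at t within {t0..}) \<and> D \<le> - (r t + v t)"
    unfolding r_def v_def using energy_dissipation_at[OF _ assms] by blast
  from choice[OF this] obtain D where D: "\<And>t. t0 \<le> t \<Longrightarrow>
      (energy xs ys ls has_real_derivative D t) (at t within {t0..}) \<and> D t \<le> - (r t + v t)"
    by blast
  moreover have "0 \<le> r t" "0 \<le> v t" if "t0 \<le> t" for t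
    using residual_dissipation_nonneg[OF that] viscous_dissipation_nonneg[OF that] \<mu>
    unfolding r_def v_def by (metis mult_nonneg_nonneg half_gt_zero less_imp_le)+
  ultimately have "D t \<le> - r t" "D t \<le> - v t" "D t \<le> 0" if "t0 \<le> t" for t
    using that by (smt (verit))+
  then show thesis
    using that[of D] D unfolding r_def v_def by blast
qed

lemma antimono_energy:
  assumes "A xs + B ys = c"
  shows "antimono_on {t0..} (energy xs ys ls)"
proof (rule energy_dissipation[OF assms, of ls])
  fix D
  assume "\<And>t. t0 \<le> t \<Longrightarrow> (energy xs ys ls has_real_derivative D t) (at t within {t0..})"
    and "\<And>t. t0 \<le> t \<Longrightarrow> D t \<le> 0"
  then show ?thesis
    by (rule antimono_on_if_deriv_nonpos)
qed

lemma weighted_gap_le_energy: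
  assumes "t0 \<le> t"
  shows "weight t * (aug_lagrangian f g A B c \<mu> (x t) (y t) ls - aug_lagrangian f g A B c \<mu> xs ys ls)
    \<le> energy xs ys ls t"
proof -
  have "(\<sigma> t)\<^sup>2 * (\<gamma> t * \<alpha> t - \<alpha>' t - 1) - 2 * \<alpha> t * \<sigma> t * \<sigma>' t
      = \<sigma> t * (\<sigma> t * (\<gamma> t * \<alpha> t - \<alpha>' t - 1) - 2 * \<alpha> t * \<sigma>' t)"
    by (simp add: power2_eq_square algebra_simps)
  also have "\<dots> \<ge> 0"
    by (intro mult_nonneg_nonneg \<sigma>_nonneg G1 assms)
  finally show ?thesis
    unfolding energy_eq by simp
qed

lemma weighted_gap_le_initial_energy:
  assumes "t0 \<le> t" and "A xs + B ys = c"
  shows "weight t * (aug_lagrangian f g A B c \<mu> (x t) (y t) ls - aug_lagrangian f g A B c \<mu> xs ys ls)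
    \<le> energy xs ys ls t0"
  using weighted_gap_le_energy[OF assms(1), of ls xs ys] assms(1)
    monotone_onD[OF antimono_energy[OF assms(2), of ls], of t0 t] by auto

text \<open>The energy decreases for every reference multiplier.  With the zero multiplier the augmented
  gap is the objective gap plus the non-negative penalty, which gives an upper bound on the
  objective without a dual solution.\<close>

lemma objective_rate:
  assumes "(xs, ys) \<in> solution_set f g A B c"
  shows "\<exists>C>0. \<forall>t\<ge>t0. weight t > 0 \<longrightarrow>
    objective f g (x t) (y t) - optimal_value f g A B c \<le> C / weight t"
proof (intro exI[of _ "max 1 (energy xs ys 0 t0)"] conjI allI impI)
  fix t
  assume t: "t0 \<le> t" "weight t > 0"
  have feasible: "A xs + B ys = c"
    using assms by (auto simp: solution_set_def feasible_set_def)
  have "weight t * (objective f g (x t) (y t) - optimal_value f g A B c)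
      \<le> weight t * (aug_lagrangian f g A B c \<mu> (x t) (y t) 0 - aug_lagrangian f g A B c \<mu> xs ys 0)"
    unfolding aug_lagrangian_feasible[OF assms] optimal_value_eq[OF assms] using t \<mu>
    by (intro mult_left_mono) (auto simp: aug_lagrangian_def lagrangian_def)
  also have "\<dots> \<le> max 1 (energy xs ys 0 t0)"
    using weighted_gap_le_initial_energy[OF t(1) feasible, of 0] by linarith
  finally show "objective f g (x t) (y t) - optimal_value f g A B c
      \<le> max 1 (energy xs ys 0 t0) / weight t"
    using t by (simp add: pos_le_divide_eq mult.commute)
qed simp

lemma continuous_on_\<sigma>: "continuous_on {t0..} \<sigma>"
  by (rule has_real_derivative_imp_continuous_on) (use \<sigma>_deriv in auto)

text \<open>Although \<open>\<sigma>'\<close> may be discontinuous, it enters only through the product \<open>\<alpha> * \<sigma> * \<sigma>'\<close>, which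
  is a combination of continuous functions and of the differentiable function in \<open>G3\<close>.\<close>

lemma continuous_on_viscosity: "continuous_on {t0..} viscosity"
proof -
  define H where "H s = \<sigma> s * (\<sigma> s * (\<gamma> s * \<alpha> s - \<alpha>' s) - 2 * \<alpha> s * \<sigma>' s)" for s
  have H: "continuous_on {t0..} H"
    unfolding H_def by (rule has_real_derivative_imp_continuous_on) (use G3_deriv in auto)
  have \<alpha>: "continuous_on {t0..} \<alpha>" "continuous_on {t0..} \<alpha>'"
    using \<alpha>_C1 by (auto dest: C1_with_deriv_imp_continuous)
  have viscosity_eq: "viscosity = (\<lambda>t. \<alpha> t * ((\<sigma> t)\<^sup>2 * (\<gamma> t * \<alpha> t - \<alpha>' t - 1)
      - ((\<sigma> t)\<^sup>2 * (\<gamma> t * \<alpha> t - \<alpha>' t) - H t) / 2))"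
    by (auto simp: H_def power2_eq_square field_simps)
  show ?thesis
    unfolding viscosity_eq by (intro continuous_intros continuous_on_\<sigma> H \<alpha> \<gamma>_cont) simp
qed

lemma continuous_on_trajectory:
  "continuous_on {t0..} x" "continuous_on {t0..} y"
  "continuous_on {t0..} x1" "continuous_on {t0..} y1" "continuous_on {t0..} l1"
  using trials
  by (auto simp: trials_solution_def dest: C1_with_deriv_imp_continuous)

lemma continuous_on_residual: "continuous_on {t0..} residual"
  by (intro continuous_intros bounded_linear.continuous_on[OF A] bounded_linear.continuous_on[OF B]
      continuous_on_trajectory)

section \<open>Rates and integrability at a saddle point\<close>

context
  fixes xs :: 'a and ys :: 'b and ls :: 'z
  assumes saddle: "(xs, ys, ls) \<in> saddle_points f g A B c"
begin

abbreviation lagrangian_gap :: "real \<Rightarrow> real" where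
  "lagrangian_gap t \<equiv> lagrangian f g A B c (x t) (y t) ls - lagrangian f g A B c xs ys ls"

lemma saddle_feasible: "A xs + B ys = c"
  using saddle_point_imp_solution[OF saddle] by (auto simp: solution_set_def feasible_set_def)

lemma lagrangian_gap_nonneg: "0 \<le> lagrangian_gap t"
  using saddle by (auto simp: saddle_points_def)

lemma lagrangian_gap_eq:
  "lagrangian_gap t
    = objective f g (x t) (y t) - optimal_value f g A B c + ls \<bullet> residual t"
  by (simp add: lagrangian_def saddle_feasible optimal_value_eq[OF saddle_point_imp_solution[OF saddle]])

lemma aug_lagrangian_gap_eq:
  "aug_lagrangian f g A B c \<mu> (x t) (y t) ls - aug_lagrangian f g A B c \<mu> xs ys ls
    = lagrangian_gap t + \<mu> / 2 * (norm (residual t))\<^sup>2"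
  by (simp add: aug_lagrangian_def saddle_feasible)

lemma weight_nonneg: "t0 \<le> t \<Longrightarrow> 0 \<le> weight t"
  using b_nonneg by simp

lemma energy_nonneg:
  assumes "t0 \<le> t"
  shows "0 \<le> energy xs ys ls t"
proof -
  have "0 \<le> weight t * (lagrangian_gap t + \<mu> / 2 * (norm (residual t))\<^sup>2)"
    using lagrangian_gap_nonneg[of t] \<mu> by (intro mult_nonneg_nonneg weight_nonneg assms) simp
  then show ?thesis
    using weighted_gap_le_energy[OF assms, of ls xs ys] unfolding aug_lagrangian_gap_eq by linarith
qed

text \<open>Both summands of the augmented gap are non-negative, so that the energy bounds each of them.\<close>

lemma weighted_bounds:
  assumes "t0 \<le> t"
  shows "weight t * lagrangian_gap t \<le> energy xs ys ls t0"
    and "weight t * (norm (residual t))\<^sup>2 \<le> 2 / \<mu> * energy xs ys ls t0"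
proof -
  have total: "weight t * lagrangian_gap t + \<mu> / 2 * (weight t * (norm (residual t))\<^sup>2)
      \<le> energy xs ys ls t0"
    using weighted_gap_le_initial_energy[OF assms saddle_feasible, of ls]
    unfolding aug_lagrangian_gap_eq by (simp only: distrib_left mult.left_commute)
  have gap: "0 \<le> weight t * lagrangian_gap t"
    by (intro mult_nonneg_nonneg weight_nonneg lagrangian_gap_nonneg assms)
  have "0 \<le> \<mu> / 2 * (weight t * (norm (residual t))\<^sup>2)"
    using \<mu> by (intro mult_nonneg_nonneg weight_nonneg assms) auto
  with total show "weight t * lagrangian_gap t \<le> energy xs ys ls t0"
    by linarith
  have "\<mu> / 2 * (weight t * (norm (residual t))\<^sup>2) \<le> energy xs ys ls t0"
    using total gap by linarith
  then show "weight t * (norm (residual t))\<^sup>2 \<le> 2 / \<mu> * energy xs ys ls t0"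
    using \<mu> by (simp add: field_simps)
qed

lemma lagrangian_rate:
  "\<exists>C>0. \<forall>t\<ge>t0. weight t > 0 \<longrightarrow> lagrangian_gap t \<le> C / weight t"
proof (intro exI[of _ "energy xs ys ls t0 + 1"] conjI allI impI)
  show "0 < energy xs ys ls t0 + 1"
    using energy_nonneg[of t0] by simp
  fix t
  assume "t0 \<le> t" "weight t > 0"
  moreover have "weight t * lagrangian_gap t \<le> energy xs ys ls t0 + 1"
    using weighted_bounds(1)[OF \<open>t0 \<le> t\<close>] by linarith
  ultimately show "lagrangian_gap t \<le> (energy xs ys ls t0 + 1) / weight t"
    by (simp only: pos_le_divide_eq mult.commute)
qed

lemma residual_rate:
  "\<exists>C>0. \<forall>t\<ge>t0. weight t > 0 \<longrightarrow> (norm (residual t))\<^sup>2 \<le> C / weight t"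
proof (intro exI[of _ "2 / \<mu> * energy xs ys ls t0 + 1"] conjI allI impI)
  show "0 < 2 / \<mu> * energy xs ys ls t0 + 1"
    using energy_nonneg[of t0] \<mu> by (intro add_nonneg_pos mult_nonneg_nonneg) auto
  fix t
  assume "t0 \<le> t" "weight t > 0"
  moreover have "weight t * (norm (residual t))\<^sup>2 \<le> 2 / \<mu> * energy xs ys ls t0 + 1"
    using weighted_bounds(2)[OF \<open>t0 \<le> t\<close>] by linarith
  ultimately show "(norm (residual t))\<^sup>2 \<le> (2 / \<mu> * energy xs ys ls t0 + 1) / weight t"
    by (simp only: pos_le_divide_eq mult.commute)
qed

text \<open>The Lagrangian gap is non-negative, so the objective can undercut the optimal value by at most
  \<open>norm ls * norm (residual t)\<close>, and the residual itself is only controlled by the inverse square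
  root of the weight.\<close>

lemma objective_lower_rate:
  "\<exists>C>0. \<forall>t\<ge>t0. weight t > 0 \<longrightarrow>
    - C / (\<alpha> t * \<sigma> t * sqrt (b t)) \<le> objective f g (x t) (y t) - optimal_value f g A B c"
proof -
  define K where "K = norm ls * sqrt (2 / \<mu> * energy xs ys ls t0) + 1"
  have "K > 0"
    unfolding K_def using energy_nonneg[of t0] \<mu>
    by (intro add_nonneg_pos mult_nonneg_nonneg real_sqrt_ge_zero) auto
  moreover have "- K / (\<alpha> t * \<sigma> t * sqrt (b t))
      \<le> objective f g (x t) (y t) - optimal_value f g A B c"
    if t: "t0 \<le> t" "weight t > 0" for t
  proof -
    define s where "s = \<alpha> t * \<sigma> t * sqrt (b t)"
    have s2: "s\<^sup>2 = weight t"
      using b_nonneg[OF t(1)] by (simp add: s_def power_mult_distrib)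
    have "0 \<le> s"
      unfolding s_def using t by (simp add: \<alpha>_nonneg \<sigma>_nonneg b_nonneg)
    with s2 t(2) have "0 < s"
      by (cases "s = 0") auto
    have "(s * norm (residual t))\<^sup>2 \<le> 2 / \<mu> * energy xs ys ls t0"
      using weighted_bounds(2)[OF t(1)] by (simp only: power_mult_distrib s2)
    then have "s * norm (residual t) \<le> sqrt (2 / \<mu> * energy xs ys ls t0)"
      by (rule real_le_rsqrt)
    then have "norm ls * (s * norm (residual t)) \<le> K"
      unfolding K_def using mult_left_mono[OF _ norm_ge_zero[of ls]] by (smt (verit))
    moreover have "s * (ls \<bullet> residual t) \<le> s * (norm ls * norm (residual t))"
      using \<open>0 < s\<close> by (intro mult_left_mono norm_cauchy_schwarz) simp
    moreover have "0 \<le> s * lagrangian_gap t"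
      using \<open>0 < s\<close> lagrangian_gap_nonneg[of t] by (intro mult_nonneg_nonneg) auto
    ultimately have "- K \<le> s * (objective f g (x t) (y t) - optimal_value f g A B c)"
      unfolding lagrangian_gap_eq distrib_left mult.left_commute[of s "norm ls"] by linarith
    then show ?thesis
      unfolding s_def[symmetric] using \<open>0 < s\<close> by (simp only: pos_divide_le_eq mult.commute)
  qed
  ultimately show ?thesis
    by blast
qed

lemma residual_integrable:
  "set_integrable lborel {t0..} (\<lambda>t. \<alpha> t * (\<sigma> t)\<^sup>2 * b t * (norm (residual t))\<^sup>2)"
proof (rule energy_dissipation[OF saddle_feasible, of ls])
  fix D
  assume deriv: "\<And>t. t0 \<le> t \<Longrightarrow> (energy xs ys ls has_real_derivative D t) (at t within {t0..})"
    and D: "\<And>t. t0 \<le> t \<Longrightarrow>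
      D t \<le> - (\<mu> / 2 * (\<alpha> t * (\<sigma> t)\<^sup>2 * b t * (norm (residual t))\<^sup>2))"
  have "set_integrable lborel {t0..}
      (\<lambda>t. \<mu> / 2 * (\<alpha> t * (\<sigma> t)\<^sup>2 * b t * (norm (residual t))\<^sup>2))"
  proof (rule set_integrable_dissipation[OF deriv energy_nonneg _ _ D])
    show "continuous_on {t0..} (\<lambda>t. \<mu> / 2 * (\<alpha> t * (\<sigma> t)\<^sup>2 * b t * (norm (residual t))\<^sup>2))"
      by (intro continuous_on_mult continuous_on_const continuous_on_power continuous_on_norm
          continuous_on_residual C1_with_deriv_imp_continuous(1)[OF \<alpha>_C1] b_cont continuous_on_\<sigma>)
    show "0 \<le> \<mu> / 2 * (\<alpha> t * (\<sigma> t)\<^sup>2 * b t * (norm (residual t))\<^sup>2)" if "t0 \<le> t" for t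
      using \<mu> by (intro mult_nonneg_nonneg[OF _ residual_dissipation_nonneg[OF that]]) simp
  qed
  then show ?thesis
    using \<mu> by (subst (asm) set_integrable_mult_right_iff) auto
qed

lemma velocity_integrable:
  "set_integrable lborel {t0..} (\<lambda>t. viscosity t * (norm (x1 t, y1 t, l1 t))\<^sup>2)"
proof (rule energy_dissipation[OF saddle_feasible, of ls])
  fix D
  assume deriv: "\<And>t. t0 \<le> t \<Longrightarrow> (energy xs ys ls has_real_derivative D t) (at t within {t0..})"
    and D: "\<And>t. t0 \<le> t \<Longrightarrow> D t \<le> - (viscosity t * (norm (x1 t, y1 t, l1 t))\<^sup>2)"
  show ?thesis
  proof (rule set_integrable_dissipation[OF deriv energy_nonneg _ _ D])
    show "continuous_on {t0..} (\<lambda>t. viscosity t * (norm (x1 t, y1 t, l1 t))\<^sup>2)"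
      by (intro continuous_on_mult[OF continuous_on_viscosity] continuous_on_power
          continuous_on_norm continuous_on_Pair continuous_on_trajectory)
    show "0 \<le> viscosity t * (norm (x1 t, y1 t, l1 t))\<^sup>2" if "t0 \<le> t" for t
      by (rule viscous_dissipation_nonneg[OF that])
  qed
qed

end

end

section \<open>Convergence rates for the trajectory\<close>

theorem theorem3p1:
  fixes f :: "'a::{real_inner,banach} \<Rightarrow> real" and gf :: "'a \<Rightarrow> 'a"
    and g :: "'b::{real_inner,banach} \<Rightarrow> real" and gg :: "'b \<Rightarrow> 'b"
    and A :: "'a \<Rightarrow> 'z::{real_inner,banach}" and B :: "'b \<Rightarrow> 'z" and c :: 'z
    and \<mu> t0 :: real
    and \<gamma> \<gamma>' \<alpha> \<alpha>' b b' \<sigma> \<sigma>' G3' G4' :: "real \<Rightarrow> real"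
    and x x1 x2 :: "real \<Rightarrow> 'a" and y y1 y2 :: "real \<Rightarrow> 'b" and l l1 l2 :: "real \<Rightarrow> 'z"
  assumes "convex_on UNIV f" and "\<And>u. GDERIV f u :> gf u" and "continuous_on UNIV gf"
    and "convex_on UNIV g" and "\<And>u. GDERIV g u :> gg u" and "continuous_on UNIV gg"
    and "bounded_linear A" and "bounded_linear B"
    and "solution_set f g A B c \<noteq> {}"
    and "\<mu> > 0"
    and "C1_with_deriv \<gamma> \<gamma>' {t0..}" and "\<And>t. t \<ge> t0 \<Longrightarrow> \<gamma> t \<ge> 0"
    and "C1_with_deriv \<alpha> \<alpha>' {t0..}" and "\<And>t. t \<ge> t0 \<Longrightarrow> \<alpha> t \<ge> 0"
    and "C1_with_deriv b b' {t0..}" and "\<And>t. t \<ge> t0 \<Longrightarrow> b t \<ge> 0"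
    and "\<And>t. t \<ge> t0 \<Longrightarrow> (\<sigma> has_real_derivative \<sigma>' t) (at t within {t0..})"
    and "\<And>t. t \<ge> t0 \<Longrightarrow> \<sigma> t \<ge> 0"
    and G1: "\<And>t. t \<ge> t0 \<Longrightarrow> \<sigma> t * (\<gamma> t * \<alpha> t - \<alpha>' t - 1) - 2 * \<alpha> t * \<sigma>' t \<ge> 0"
    and G2: "\<And>t. t \<ge> t0 \<Longrightarrow> \<sigma> t * (\<gamma> t * \<alpha> t - \<alpha>' t - 1) - \<alpha> t * \<sigma>' t \<ge> 0"
    and G3_deriv: "\<And>t. t \<ge> t0 \<Longrightarrow>
      ((\<lambda>s. \<sigma> s * (\<sigma> s * (\<gamma> s * \<alpha> s - \<alpha>' s) - 2 * \<alpha> s * \<sigma>' s)) has_real_derivative G3' t)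
        (at t within {t0..})"
    and G3: "\<And>t. t \<ge> t0 \<Longrightarrow> - G3' t \<ge> 0"
    and G4_deriv: "\<And>t. t \<ge> t0 \<Longrightarrow>
      ((\<lambda>s. (\<alpha> s)\<^sup>2 * (\<sigma> s)\<^sup>2 * b s) has_real_derivative G4' t) (at t within {t0..})"
    and G4: "\<And>t. t \<ge> t0 \<Longrightarrow> \<alpha> t * (\<sigma> t)\<^sup>2 * b t - G4' t = 0"
    and "trials_solution gf gg A B c \<mu> \<gamma> \<alpha> b t0 x y l x1 y1 l1 x2 y2 l2"
  shows
    "(\<forall>xs ys ls. (xs, ys) \<in> solution_set f g A B c \<longrightarrow>
        antimono_on {t0..}
          (lyapunov f g A B c \<mu> \<gamma> \<alpha> \<alpha>' b \<sigma> \<sigma>'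
            (\<lambda>t. (x t, y t, l t)) (\<lambda>t. (x1 t, y1 t, l1 t)) (xs, ys, ls)))
     \<and> (\<exists>C>0. \<forall>t\<ge>t0. (\<alpha> t)\<^sup>2 * (\<sigma> t)\<^sup>2 * b t > 0 \<longrightarrow>
          objective f g (x t) (y t) - optimal_value f g A B c \<le> C / ((\<alpha> t)\<^sup>2 * (\<sigma> t)\<^sup>2 * b t))
     \<and> (\<forall>xs ys ls. (xs, ys, ls) \<in> saddle_points f g A B c \<longrightarrow>
          (\<forall>t\<ge>t0. 0 \<le> lagrangian f g A B c (x t) (y t) ls - lagrangian f g A B c xs ys ls)
        \<and> (\<exists>C>0. \<forall>t\<ge>t0. (\<alpha> t)\<^sup>2 * (\<sigma> t)\<^sup>2 * b t > 0 \<longrightarrow>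
             lagrangian f g A B c (x t) (y t) ls - lagrangian f g A B c xs ys ls
               \<le> C / ((\<alpha> t)\<^sup>2 * (\<sigma> t)\<^sup>2 * b t))
        \<and> (\<exists>C>0. \<forall>t\<ge>t0. (\<alpha> t)\<^sup>2 * (\<sigma> t)\<^sup>2 * b t > 0 \<longrightarrow>
             (norm (A (x t) + B (y t) - c))\<^sup>2 \<le> C / ((\<alpha> t)\<^sup>2 * (\<sigma> t)\<^sup>2 * b t))
        \<and> (\<exists>C1>0. \<exists>C2>0. \<forall>t\<ge>t0. (\<alpha> t)\<^sup>2 * (\<sigma> t)\<^sup>2 * b t > 0 \<longrightarrow>
             - C1 / (\<alpha> t * \<sigma> t * sqrt (b t))
               \<le> objective f g (x t) (y t) - optimal_value f g A B c
           \<and> objective f g (x t) (y t) - optimal_value f g A B c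
               \<le> C2 / ((\<alpha> t)\<^sup>2 * (\<sigma> t)\<^sup>2 * b t))
        \<and> set_integrable lborel {t0..}
            (\<lambda>t. \<alpha> t * (\<sigma> t)\<^sup>2 * b t * (norm (A (x t) + B (y t) - c))\<^sup>2)
        \<and> set_integrable lborel {t0..}
            (\<lambda>t. \<alpha> t * \<sigma> t * (\<sigma> t * (\<gamma> t * \<alpha> t - \<alpha>' t - 1) - \<alpha> t * \<sigma>' t)
                  * (norm (x1 t, y1 t, l1 t))\<^sup>2))"
proof -
  interpret trials_trajectory f gf g gg A B c \<mu> t0 \<gamma> \<alpha> \<alpha>' b \<sigma> \<sigma>' G3' G4' x x1 x2 y y1 y2 l l1 l2
    by (rule trials_trajectory.intro)
      (fact assms C1_with_deriv_imp_continuous[OF assms(11)] C1_with_deriv_imp_continuous[OF assms(15)])+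
  have monotone: "antimono_on {t0..} (energy xs ys ls)" if "(xs, ys) \<in> solution_set f g A B c"
    for xs ys ls
    using that by (intro antimono_energy) (auto simp: solution_set_def feasible_set_def)
  obtain xs0 ys0 where "(xs0, ys0) \<in> solution_set f g A B c"
    using assms(9) by auto
  note upper = objective_rate[OF this]
  have two_sided: "\<exists>C1>0. \<exists>C2>0. \<forall>t\<ge>t0. weight t > 0 \<longrightarrow>
      - C1 / (\<alpha> t * \<sigma> t * sqrt (b t)) \<le> objective f g (x t) (y t) - optimal_value f g A B c
      \<and> objective f g (x t) (y t) - optimal_value f g A B c \<le> C2 / weight t"
    if "(xs, ys, ls) \<in> saddle_points f g A B c" for xs ys ls
    using objective_lower_rate[OF that] upper by meson
  show ?thesis
    using monotone upper two_sided lagrangian_gap_nonneg lagrangian_rate residual_rate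
      residual_integrable velocity_integrable
    by (intro conjI allI impI) blast+
qed

end
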